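(* Let $f,g:\mathbb{R}\to\mathbb{C}$ be measurable functions such that $t\mapsto f(t)\overline{g(t-x)}$ is integrable for every $x\in\mathbb{R}$. Then for all $\xi,\eta,x,\omega\in\mathbb{R}$, $$V_g(T_\xi^AM_\eta^Af)(x,\omega)=\rho_A(-\eta)\,e^{-2\pi i\xi\omega}\,V_gf\Big(x-\xi,\ \omega+\frac{a\xi-\eta}{b}\Big).$$ In particular, $|V_g(T_\xi^AM_\eta^Af)(x,\omega)|=\big|V_gf\big(x-\xi,\omega+\frac{a\xi-\eta}{b}\big)\big|$.
   Context: $A=\{a,b,c,d,p,q\}$ are real parameters with $ad-bc=1$ and $b\neq0$. The short time Fourier transform is $V_gf(x,\omega)=\int_{\mathbb{R}}f(t)\overline{g(t-x)}e^{-2\pi i\omega t}\,dt$. $\rho_A(t)=e^{\frac{\pi i}{b}(at^2+2pt)}$. The $A$-translation is $T_s^Af(t)=e^{-\frac{2\pi i a}{b}s(t-s)}f(t-s)$ and the $A$-modulation is $M_s^Af(t)=\rho_A(-s)e^{2\pi i st/b}f(t)=e^{\frac{\pi i}{b}(as^2-2ps+2st)}f(t)$. *)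

theory Defs
  imports "HOL-Analysis.Analysis"
begin

text \<open>The parameters \<open>A = {a, b, c, d, p, q}\<close>; the constraints \<open>ad - bc = 1\<close> and
  \<open>b \<noteq> 0\<close> are hypotheses of the theorem, not part of the type.\<close>

record params =
  par_a :: real
  par_b :: real
  par_c :: real
  par_d :: real
  par_p :: real
  par_q :: real

definition stft :: "(real \<Rightarrow> complex) \<Rightarrow> (real \<Rightarrow> complex) \<Rightarrow> real \<Rightarrow> real \<Rightarrow> complex" where
  "stft g f x \<omega> =
     (LINT t|lebesgue. f t * cnj (g (t - x)) * exp (- 2 * of_real pi * \<i> * of_real \<omega> * of_real t))"

definition rho :: "params \<Rightarrow> real \<Rightarrow> complex" where
  "rho A t = exp (of_real pi * \<i> / of_real (par_b A) *
                  of_real (par_a A * t\<^sup>2 + 2 * par_p A * t))"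

definition A_translation :: "params \<Rightarrow> real \<Rightarrow> (real \<Rightarrow> complex) \<Rightarrow> real \<Rightarrow> complex" where
  "A_translation A s f t =
     exp (- (2 * of_real pi * \<i> * of_real (par_a A) / of_real (par_b A)) * of_real (s * (t - s))) * f (t - s)"

definition A_modulation :: "params \<Rightarrow> real \<Rightarrow> (real \<Rightarrow> complex) \<Rightarrow> real \<Rightarrow> complex" where
  "A_modulation A s f t =
     rho A (- s) * exp (2 * of_real pi * \<i> * of_real (s * t) / of_real (par_b A)) * f t"

lemma A_modulation_altdef:
  "A_modulation A s f t =
     exp (of_real pi * \<i> / of_real (par_b A) *
          of_real (par_a A * s\<^sup>2 - 2 * par_p A * s + 2 * s * t)) * f t"
  by (simp add: A_modulation_def rho_def exp_add [symmetric] add_divide_distrib diff_divide_distrib algebra_simps)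

end

theory Submission
  imports Defs
begin

text \<open>Substitute \<open>u = t - \<xi>\<close> in the integral. The two exponentials from \<open>A\<close>-translation and
  \<open>A\<close>-modulation then combine with \<open>exp (-2\<pi>i\<omega>t)\<close> into the constant phase
  \<open>\<rho>\<^sub>A(-\<eta>) exp (-2\<pi>i\<xi>\<omega>)\<close> times the Fourier kernel at frequency \<open>\<omega> + (a\<xi> - \<eta>)/b\<close>; the phase is
  unimodular because its exponent is purely imaginary.\<close>

text \<open>The target is the completed sigma-algebra, so Borel measurability is not enough; the
  affine map of slope 1 and offset \<open>- s\<close> is an instance of the library fact.\<close>

lemma lebesgue_measurable_diff_const: "(\<lambda>t::real. t - s) \<in> lebesgue \<rightarrow>\<^sub>M lebesgue"
  using lebesgue_affine_measurable[of "\<lambda>_. 1" "- s"] by simp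

lemma distr_lebesgue_diff_const: "distr lebesgue lebesgue (\<lambda>t::real. t - s) = lebesgue"
  using lebesgue_real_affine[of 1 "- s"] by (simp add: density_1)

lemma integral_lebesgue_diff_const:
  fixes h :: "real \<Rightarrow> 'a::{banach, second_countable_topology}"
  assumes "h \<in> borel_measurable lebesgue"
  shows "(LINT t|lebesgue. h (t - s)) = (LINT t|lebesgue. h t)"
  using integral_distr[OF lebesgue_measurable_diff_const assms, of s]
  by (simp add: distr_lebesgue_diff_const)

text \<open>The Fourier kernel is continuous, hence Borel, and Borel measurability passes to the
  completion.\<close>

lemma stft_integrand_measurable:
  assumes "(\<lambda>t. f t * cnj (g (t - x))) \<in> borel_measurable lebesgue"
  shows "(\<lambda>t. f t * cnj (g (t - x)) * exp (- 2 * of_real pi * \<i> * of_real \<omega> * of_real t))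
           \<in> borel_measurable lebesgue"
proof (rule borel_measurable_times[OF assms measurable_completion])
  show "(\<lambda>t. exp (- 2 * of_real pi * \<i> * of_real \<omega> * of_real t)) \<in> borel_measurable lborel"
    unfolding measurable_lborel2 by (intro borel_measurable_continuous_onI continuous_intros)
qed

text \<open>The argument \<open>t - x\<close> is written as \<open>t - \<xi> - (x - \<xi>)\<close>
  so that the right-hand side is a constant times a function of \<open>t - \<xi>\<close>, ready for
  the substitution.\<close>

lemma stft_integrand_A_translation_modulation:
  assumes "par_b A \<noteq> 0"
  shows "A_translation A \<xi> (A_modulation A \<eta> f) t * cnj (g (t - x)) *
           exp (- 2 * of_real pi * \<i> * of_real \<omega> * of_real t) =
         rho A (- \<eta>) * exp (- 2 * of_real pi * \<i> * of_real \<xi> * of_real \<omega>) *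
           (f (t - \<xi>) * cnj (g (t - \<xi> - (x - \<xi>))) *
            exp (- 2 * of_real pi * \<i> * of_real (\<omega> + (par_a A * \<xi> - \<eta>) / par_b A) *
                 of_real (t - \<xi>)))"
proof -
  \<comment> \<open>Only the exponents depending on \<open>t\<close> are compared;
    \<open>rho A (- \<eta>)\<close> is the same constant on both sides.\<close>
  have "- (2 * of_real pi * \<i> * of_real (par_a A) / of_real (par_b A)) * of_real (\<xi> * (t - \<xi>))
          + 2 * of_real pi * \<i> * of_real (\<eta> * (t - \<xi>)) / of_real (par_b A)
          + - 2 * of_real pi * \<i> * of_real \<omega> * of_real t
        = - 2 * of_real pi * \<i> * of_real \<xi> * of_real \<omega>
          + - 2 * of_real pi * \<i> * of_real (\<omega> + (par_a A * \<xi> - \<eta>) / par_b A) *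
            of_real (t - \<xi>)"
    (is "?e1 + ?e2 + ?e3 = ?e4 + ?e5")
    using assms by (simp add: field_simps)
  then have "exp ?e1 * exp ?e2 * exp ?e3 = exp ?e4 * exp ?e5"
    by (metis exp_add)
  then show ?thesis
    by (simp add: A_translation_def A_modulation_def mult_ac)
qed

lemma norm_rho [simp]: "norm (rho A t) = 1"
  by (simp add: rho_def norm_exp_eq_Re Re_divide_of_real)

theorem proposition4p6:
  fixes A :: params and f g :: "real \<Rightarrow> complex" and \<xi> \<eta> x \<omega> :: real
  assumes "par_a A * par_d A - par_b A * par_c A = 1"
    and "par_b A \<noteq> 0"
    and "f \<in> borel_measurable lebesgue"
    and "g \<in> borel_measurable lebesgue"
    and "\<And>y. integrable lebesgue (\<lambda>t. f t * cnj (g (t - y)))"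
  shows "stft g (A_translation A \<xi> (A_modulation A \<eta> f)) x \<omega> =
           rho A (- \<eta>) * exp (- 2 * of_real pi * \<i> * of_real \<xi> * of_real \<omega>) *
           stft g f (x - \<xi>) (\<omega> + (par_a A * \<xi> - \<eta>) / par_b A)
       \<and> cmod (stft g (A_translation A \<xi> (A_modulation A \<eta> f)) x \<omega>) =
           cmod (stft g f (x - \<xi>) (\<omega> + (par_a A * \<xi> - \<eta>) / par_b A))"
proof -
  let ?x' = "x - \<xi>" and ?\<omega>' = "\<omega> + (par_a A * \<xi> - \<eta>) / par_b A"
  let ?c = "rho A (- \<eta>) * exp (- 2 * of_real pi * \<i> * of_real \<xi> * of_real \<omega>)"
  let ?h = "\<lambda>t. f t * cnj (g (t - ?x')) * exp (- 2 * of_real pi * \<i> * of_real ?\<omega>' * of_real t)"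
  \<comment> \<open>Integrability at the shift \<open>y = x - \<xi>\<close> makes the product
    measurable, as the change of variables requires.\<close>
  have "?h \<in> borel_measurable lebesgue"
    by (intro stft_integrand_measurable borel_measurable_integrable assms(5))
  then have "(LINT t|lebesgue. ?h (t - \<xi>)) = stft g f ?x' ?\<omega>'"
    unfolding stft_def by (rule integral_lebesgue_diff_const)
  moreover have "stft g (A_translation A \<xi> (A_modulation A \<eta> f)) x \<omega> =
      ?c * (LINT t|lebesgue. ?h (t - \<xi>))"
    unfolding stft_def stft_integrand_A_translation_modulation[OF assms(2)]
    by (rule integral_mult_right_zero)
  ultimately have "stft g (A_translation A \<xi> (A_modulation A \<eta> f)) x \<omega> = ?c * stft g f ?x' ?\<omega>'"
    by simp
  moreover have "norm ?c = 1"
    by (simp add: norm_mult norm_exp_eq_Re)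
  ultimately show ?thesis
    by (simp only: norm_mult mult_1 simp_thms)
qed

end
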